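(* Let $\mathcal{A}$ be any evacuation algorithm for one sender and $n_r\ge 1$ receivers. Then \[\mathrm{CR}(\mathcal{A})\ge\begin{cases}3+2\sqrt{2}, & n_r=1,\\ 2+\sqrt{5}, & n_r>1.\end{cases}\]
   Context: Evacuation problem on the line: $n\ge 2$ agents start at time $0$ at the origin of the real line. Each agent can move in either direction with any speed at most $1$, changing speed and direction instantaneously and arbitrarily often. A target (exit) is at an unknown point $x\in\mathbb{R}$ with $|x|>1$; an agent detects the target when it visits its location. Co-located agents can always exchange information (face-to-face communication). Each agent is either a sender (can transmit messages wirelessly to all other agents at any distance, but can receive messages only face-to-face) or a receiver (can receive wireless messages from any distance, but can transmit only face-to-face). The types of all agents and the algorithm are known to all agents in advance. An evacuation algorithm $\mathcal{A}$ prescribes the movement of every agent, both the search trajectory followed until the agent finds or is informed of the target, and its subsequent actions. $E(\mathcal{A},x)$ is the time at which the last agent reaches the target when it is at $x$, and the competitive ratio is $\mathrm{CR}(\mathcal{A})=\sup_{|x|>1}E(\mathcal{A},x)/|x|$. *)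

theory Defs
  imports "HOL-Analysis.Analysis"
begin

datatype agent_kind = Sender | Receiver

text \<open>A trajectory of an agent of maximum speed 1 starting at the origin of the line; only the
  times in \<open>{0..}\<close> are meaningful.\<close>

definition trajectory :: "(real \<Rightarrow> real) \<Rightarrow> bool" where
  "trajectory f \<longleftrightarrow> f 0 = 0 \<and> 1-lipschitz_on {0..} f"

text \<open>For agents moving along the trajectories \<open>p\<close> with the target at \<open>x\<close>, the predicate
  \<open>informed kind p x i t\<close> says that agent \<open>i\<close> knows the target at time \<open>t\<close>. Every possible
  communication takes place, which is no restriction on algorithms because an informed agent is
  free to ignore what it knows.\<close>

inductive informed ::
    "('a \<Rightarrow> agent_kind) \<Rightarrow> ('a \<Rightarrow> real \<Rightarrow> real) \<Rightarrow> real \<Rightarrow> 'a \<Rightarrow> real \<Rightarrow> bool"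
  for kind :: "'a \<Rightarrow> agent_kind" and p :: "'a \<Rightarrow> real \<Rightarrow> real" and x :: real
where
  finds: "0 \<le> t \<Longrightarrow> p i t = x \<Longrightarrow> informed kind p x i t"
| remembers: "informed kind p x i s \<Longrightarrow> s \<le> t \<Longrightarrow> informed kind p x i t"
| face_to_face: "informed kind p x j t \<Longrightarrow> p i t = p j t \<Longrightarrow> informed kind p x i t"
| wireless: "informed kind p x j t \<Longrightarrow> kind j = Sender \<Longrightarrow> kind i = Receiver
    \<Longrightarrow> informed kind p x i t"

text \<open>\<open>search A i\<close> is the search trajectory of agent \<open>i\<close>, and \<open>move A x i\<close> is the trajectory
  that it actually follows when the target is at \<open>x\<close>. The latter may depend on \<open>x\<close> only once
  the agent is informed; since everything is deterministic, the knowledge of an informed agent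
  is a function of \<open>x\<close>.\<close>

record 'a algorithm =
  search :: "'a \<Rightarrow> real \<Rightarrow> real"
  move :: "real \<Rightarrow> 'a \<Rightarrow> real \<Rightarrow> real"

definition evacuation_algorithm :: "('a \<Rightarrow> agent_kind) \<Rightarrow> 'a algorithm \<Rightarrow> bool" where
  "evacuation_algorithm kind A \<longleftrightarrow>
     (\<forall>i. trajectory (search A i)) \<and>
     (\<forall>x i. \<bar>x\<bar> > 1 \<longrightarrow>
        trajectory (move A x i) \<and>
        (\<forall>t\<ge>0. \<not> informed kind (move A x) x i t \<longrightarrow> move A x i t = search A i t))"

text \<open>The value is \<open>\<infinity>\<close> if some agent never reaches the target.\<close>

definition evacuation_time :: "'a algorithm \<Rightarrow> real \<Rightarrow> ereal" where
  "evacuation_time A x = (SUP i. INF t\<in>{t. 0 \<le> t \<and> move A x i t = x}. ereal t)"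

definition competitive_ratio :: "'a algorithm \<Rightarrow> ereal" where
  "competitive_ratio A = (SUP x\<in>{x. \<bar>x\<bar> > 1}. evacuation_time A x / ereal \<bar>x\<bar>)"

end

theory Submission
  imports Defs
begin

text \<open>Suppose that every target is reached in time less than \<open>c * \<bar>x\<bar>\<close> and put \<open>\<beta> = c - 1\<close>.
  An agent at position \<open>q\<close> at time \<open>t\<close> must know the target \<open>x\<close> on the opposite side with
  \<open>\<bar>x\<bar> = (t + \<bar>q\<bar>) / \<beta>\<close>, since otherwise it reaches \<open>x\<close> too late. Its knowledge travelled
  at speed at most 1, either all the way from \<open>x\<close> or from \<open>x\<close> to the sender. If all agents
  eventually satisfy \<open>\<bar>q\<bar> \<le> \<rho> * t\<close>, then \<open>x\<close> was found no earlier than \<open>\<bar>x\<bar> / \<rho>\<close>, which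
  restricts \<open>q\<close> further, first for the sender and then for the receivers. For \<open>\<beta>\<close> below the
  threshold, \<open>\<rho>\<close> decreases by at least a fixed amount in each round, and becomes negative.\<close>

section \<open>Trajectories\<close>

lemma trajectory_dist_le:
  assumes "trajectory f" "0 \<le> a" "a \<le> b"
  shows "\<bar>f b - f a\<bar> \<le> b - a"
  using lipschitz_onD[of 1 "{0..}" f b a] assms by (auto simp: trajectory_def dist_real_def)

lemma trajectory_abs_le:
  assumes "trajectory f" "0 \<le> t"
  shows "\<bar>f t\<bar> \<le> t"
  using trajectory_dist_le[OF assms(1) order_refl assms(2)] assms by (simp add: trajectory_def)

lemma trajectory_continuous_on:
  assumes "trajectory f" "S \<subseteq> {0..}"
  shows "continuous_on S f"
  using assms lipschitz_on_continuous_on lipschitz_on_subset unfolding trajectory_def by blast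

text \<open>Agreement before \<open>T\<close> extends to \<open>T\<close> by continuity. An agent
  finding the target is informed at that very instant, so its ignorance is only available strictly
  before it.\<close>

lemma trajectory_eq_at_end:
  assumes f: "trajectory f" and g: "trajectory g" and "0 \<le> T"
    and eq: "\<And>t. 0 \<le> t \<Longrightarrow> t < T \<Longrightarrow> f t = g t"
  shows "f T = g T"
proof (rule ccontr)
  assume ne: "f T \<noteq> g T"
  define d where "d = \<bar>f T - g T\<bar>"
  define t where "t = max 0 (T - d / 4)"
  have "0 < T"
    using f g ne \<open>0 \<le> T\<close> by (cases "T = 0") (auto simp: trajectory_def)
  then have t: "0 \<le> t" "t < T" "T - t \<le> d / 4" and "0 < d"
    using ne by (auto simp: t_def d_def max_def)
  then show False
    using eq[of t] trajectory_dist_le[OF f, of t T] trajectory_dist_le[OF g, of t T]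
    by (auto simp: d_def)
qed

text \<open>The source of a gain independent of \<open>\<rho>\<close>: up to \<open>1 / 2\<close>
  the square contributes at least 1, beyond it the linear term contributes at least
  \<open>e / 2\<close>.\<close>

lemma quadratic_lower_bound:
  fixes \<rho> e k :: real
  assumes "0 \<le> \<rho>" "0 \<le> e" "4 \<le> k"
  shows "min 1 (e / 2) \<le> k * (\<rho> - 1)\<^sup>2 + e * \<rho>"
proof (cases "\<rho> \<le> 1 / 2")
  case True
  then have "(1 / 2)\<^sup>2 \<le> (1 - \<rho>)\<^sup>2"
    by (intro power_mono) auto
  then have "4 * (1 / 2)\<^sup>2 \<le> k * (\<rho> - 1)\<^sup>2"
    using assms(3) by (intro mult_mono) (auto simp: power2_commute)
  then show ?thesis
    using assms(1,2) by (simp add: power2_eq_square min.coboundedI1 add_increasing2)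
next
  case False
  then have "e * (1 / 2) \<le> e * \<rho>"
    using assms(2) by (intro mult_left_mono) auto
  moreover have "0 \<le> k * (\<rho> - 1)\<^sup>2"
    using assms(3) by simp
  ultimately show ?thesis
    by linarith
qed

section \<open>Propagation of information\<close>

lemma informed_imp_found:
  assumes "informed kind p x i t"
  shows "\<exists>j u. 0 \<le> u \<and> u \<le> t \<and> p j u = x"
  using assms by induction (auto intro: order_trans)

text \<open>The situation to be refuted for \<open>c\<close> below the claimed bound. Finiteness of
  the agent type yields a first discovery time.\<close>

locale fast_evacuation =
  fixes kind :: "'a::finite \<Rightarrow> agent_kind" and A :: "'a algorithm" and s :: 'a and c :: real
  assumes algorithm: "evacuation_algorithm kind A"
    and sender: "kind i = Sender \<longleftrightarrow> i = s"
    and fast: "\<bar>x\<bar> > 1 \<Longrightarrow> \<exists>t\<ge>0. move A x i t = x \<and> t < c * \<bar>x\<bar>"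
    and c_gt_4: "c > 4"
begin

abbreviation knows :: "real \<Rightarrow> 'a \<Rightarrow> real \<Rightarrow> bool" where
  "knows x \<equiv> informed kind (move A x) x"

lemma trajectory_search: "trajectory (search A i)"
  using algorithm by (simp add: evacuation_algorithm_def)

lemma trajectory_move: "\<bar>x\<bar> > 1 \<Longrightarrow> trajectory (move A x i)"
  using algorithm by (simp add: evacuation_algorithm_def)

lemma move_eq_search: "\<bar>x\<bar> > 1 \<Longrightarrow> 0 \<le> t \<Longrightarrow> \<not> knows x i t \<Longrightarrow> move A x i t = search A i t"
  using algorithm by (simp add: evacuation_algorithm_def)

lemma move_eq_search_until:
  assumes "\<bar>x\<bar> > 1" "0 \<le> T" "\<And>t. 0 \<le> t \<Longrightarrow> t < T \<Longrightarrow> \<not> knows x i t"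
  shows "move A x i T = search A i T"
  using assms trajectory_eq_at_end[OF trajectory_move trajectory_search] move_eq_search by blast

text \<open>The visit times form a finite union of closed sets, so they have a minimum
  \<open>T\<close>. Nobody is informed earlier, so the finder is still on its search trajectory at
  \<open>T\<close>.\<close>

lemma first_find:
  assumes x: "\<bar>x\<bar> > 1"
  obtains j T where "search A j T = x" "\<bar>x\<bar> \<le> T" "\<And>i t. knows x i t \<Longrightarrow> T \<le> t"
proof -
  define S where "S = (\<Union>j. {t \<in> {0..}. move A x j t = x})"
  have "closed S"
    unfolding S_def using trajectory_continuous_on[OF trajectory_move[OF x]]
    by (intro closed_UN continuous_closed_preimage_constant ballI) auto
  moreover have "S \<noteq> {}"
    using fast[OF x] by (force simp: S_def)
  moreover have bdd: "bdd_below S"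
    by (auto simp: S_def intro: bdd_belowI[of _ 0])
  ultimately have T: "Inf S \<in> S"
    using closed_contains_Inf by blast
  have first: "Inf S \<le> t" if know: "knows x i t" for i t
  proof -
    obtain j u where "0 \<le> u" "u \<le> t" "move A x j u = x"
      using informed_imp_found[OF know] by blast
    then have "u \<in> S"
      by (auto simp: S_def)
    then show ?thesis
      using cInf_lower[OF _ bdd] \<open>u \<le> t\<close> by force
  qed
  obtain j where j: "0 \<le> Inf S" "move A x j (Inf S) = x"
    using T by (auto simp: S_def)
  have find: "search A j (Inf S) = x"
    using move_eq_search_until[OF x j(1), of j] first[of j] j(2) by force
  then have "\<bar>x\<bar> \<le> Inf S"
    using trajectory_abs_le[OF trajectory_search j(1)] by metis
  then show thesis
    using that find first by blast
qed

text \<open>An agent ignorant at \<open>t\<close> has not visited \<open>x\<close> and is still on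
  its search trajectory, so it arrives no earlier than \<open>t\<close> plus its distance from
  \<open>x\<close>, too late for \<open>fast\<close>.\<close>

lemma knows_if_far:
  assumes x: "\<bar>x\<bar> > 1" and t: "0 \<le> t"
    and far: "c * \<bar>x\<bar> \<le> t + \<bar>search A i t - x\<bar>"
  shows "knows x i t"
proof (rule ccontr)
  assume ignorant: "\<not> knows x i t"
  obtain u where u: "0 \<le> u" "move A x i u = x" "u < c * \<bar>x\<bar>"
    using fast[OF x] by blast
  have "t < u"
  proof (rule ccontr)
    assume "\<not> t < u"
    then have "knows x i t"
      using informed.finds[of u "move A x" i x kind] u informed.remembers
      by (metis linorder_not_less)
    then show False
      using ignorant by blast
  qed
  then show False
    using trajectory_dist_le[OF trajectory_move[OF x], of t u i] u far t
      move_eq_search[OF x t ignorant] by auto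
qed

text \<open>The forward light cone of the discovery of \<open>x\<close> at time \<open>T\<close> is
  never left at speed at most 1.\<close>

lemma in_cone_mono:
  assumes "trajectory f" "0 \<le> u" "u \<le> t" "\<bar>f u - x\<bar> \<le> u - T"
  shows "\<bar>f t - x\<bar> \<le> t - T"
  using trajectory_dist_le[OF assms(1-3)] assms(4) by linarith

text \<open>A meeting shares the position and remembering stays in the cone. A wireless message
  comes from \<open>s\<close>, so both alternatives for its origin put \<open>s\<close> in the
  cone.\<close>

lemma knows_imp_move_in_cone:
  assumes x: "\<bar>x\<bar> > 1" and T: "0 \<le> T" and first: "\<And>i t. knows x i t \<Longrightarrow> T \<le> t"
    and know: "knows x i t"
  shows "\<bar>move A x i t - x\<bar> \<le> t - T \<or> \<bar>move A x s t - x\<bar> \<le> t - T"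
  using know
proof induction
  case (finds t i)
  then show ?case
    using first[of i t] informed.finds[of t "move A x" i x kind] by simp
next
  case (remembers i u t)
  then have "0 \<le> u"
    using first[OF remembers(1)] T by simp
  then show ?case
    using in_cone_mono[OF trajectory_move[OF x]] remembers by blast
qed (auto simp: sender)

text \<open>Until it enters the cone the agent is ignorant and follows its search trajectory, which
  therefore enters at the same moment \<open>Inf S\<close> and stays inside.\<close>

lemma search_in_cone:
  assumes x: "\<bar>x\<bar> > 1" and T: "0 \<le> T" "T \<le> t"
    and near: "\<bar>move A x i t - x\<bar> \<le> t - T"
    and know: "\<And>v. v \<le> t \<Longrightarrow> knows x i v \<Longrightarrow> T \<le> v \<and> \<bar>move A x i v - x\<bar> \<le> v - T"
  shows "\<bar>search A i t - x\<bar> \<le> t - T"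
proof -
  define S where "S = {T..} \<inter> (\<lambda>u. \<bar>move A x i u - x\<bar> - u) -` {..- T}"
  have "closed S"
    unfolding S_def using T trajectory_continuous_on[OF trajectory_move[OF x]]
    by (intro continuous_closed_preimage continuous_intros) auto
  moreover have "t \<in> S"
    using T near by (simp add: S_def)
  moreover have bdd: "bdd_below S"
    by (auto simp: S_def intro: bdd_belowI[of _ T])
  ultimately have u: "Inf S \<in> S"
    using closed_contains_Inf by blast
  have le: "Inf S \<le> v" if "v \<in> S" for v
    using cInf_lower[OF that bdd] .
  have "\<not> knows x i v" if "v < Inf S" for v
    using know[of v] le[of v] le[OF \<open>t \<in> S\<close>] that by (force simp: S_def)
  then have "move A x i (Inf S) = search A i (Inf S)"
    using move_eq_search_until[OF x] u T by (auto simp: S_def)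
  then show ?thesis
    using in_cone_mono[OF trajectory_search, of "Inf S" t i x T] u T le[OF \<open>t \<in> S\<close>]
    by (auto simp: S_def)
qed

text \<open>Replaces the target-dependent motion by the search trajectories, to which the speed
  bounds refer.\<close>

lemma knows_imp_search_in_cone:
  assumes x: "\<bar>x\<bar> > 1" and T: "0 \<le> T" and first: "\<And>i t. knows x i t \<Longrightarrow> T \<le> t"
    and know: "knows x i t"
  shows "\<bar>search A i t - x\<bar> \<le> t - T \<or> \<bar>search A s t - x\<bar> \<le> t - T"
proof -
  have cone: "\<bar>move A x i v - x\<bar> \<le> v - T \<or> \<bar>move A x s v - x\<bar> \<le> v - T"
    if "knows x i v" for i v
    using knows_imp_move_in_cone[OF x T _ that] first by blast
  have t: "T \<le> t"
    using first[OF know] .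
  show ?thesis
  proof (cases "\<bar>move A x s t - x\<bar> \<le> t - T")
    case True
    then show ?thesis
      using search_in_cone[OF x T t True] first cone by blast
  next
    case False
    \<comment> \<open>The sender is outside the cone at \<open>t\<close>, hence also before, so up
      to \<open>t\<close> agent \<open>i\<close> can only be informed while in the cone
      itself.\<close>
    have "\<bar>move A x i v - x\<bar> \<le> v - T" if "v \<le> t" "knows x i v" for v
      using in_cone_mono[OF trajectory_move[OF x], of v t s x T] first[OF that(2)] T
        cone[OF that(2)] that False by linarith
    then show ?thesis
      using search_in_cone[OF x T t] first cone[OF know] False by blast
  qed
qed

definition \<beta> :: real where "\<beta> = c - 1"

lemma \<beta>_gt_3: "\<beta> > 3"
  using c_gt_4 by (simp add: \<beta>_def)

lemma opposite_target:
  assumes t: "\<beta> < t"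
  obtains x j T where "t + \<bar>search A i t\<bar> = \<beta> * \<bar>x\<bar>" "search A j T = x" "\<bar>x\<bar> \<le> T" "T \<le> t"
    "\<bar>search A i t - x\<bar> = \<bar>x\<bar> + \<bar>search A i t\<bar>"
    "\<bar>x\<bar> + \<bar>search A i t\<bar> \<le> t - T \<or> i \<noteq> s \<and> \<bar>x\<bar> - \<bar>search A s t\<bar> \<le> t - T"
proof -
  define q where "q = search A i t"
  \<comment> \<open>This value makes the hypothesis \<open>far\<close> of
    \<open>knows_if_far\<close> an equality for the opposite target; \<open>\<beta> < t\<close>
    ensures \<open>m > 1\<close>.\<close>
  define m where "m = (t + \<bar>q\<bar>) / \<beta>"
  define x where "x = (if q \<ge> 0 then - m else m)"
  have t0: "0 \<le> t" and m: "m > 1" "t + \<bar>q\<bar> = \<beta> * m"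
    using t \<beta>_gt_3 by (auto simp: m_def field_simps)
  then have x: "\<bar>x\<bar> = m" "\<bar>x\<bar> > 1" and diff: "\<bar>q - x\<bar> = \<bar>x\<bar> + \<bar>q\<bar>"
    by (auto simp: x_def)
  obtain j T where T: "search A j T = x" "\<bar>x\<bar> \<le> T" and first: "\<And>i t. knows x i t \<Longrightarrow> T \<le> t"
    using first_find[OF x(2)] by blast
  have "c * \<bar>x\<bar> \<le> t + \<bar>search A i t - x\<bar>"
    using m diff x(1) by (simp add: q_def \<beta>_def algebra_simps)
  then have know: "knows x i t"
    using knows_if_far[OF x(2) t0] by blast
  have "0 \<le> T"
    using T by simp
  then have "\<bar>q - x\<bar> \<le> t - T \<or> i \<noteq> s \<and> \<bar>search A s t - x\<bar> \<le> t - T"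
    using knows_imp_search_in_cone[OF x(2) \<open>0 \<le> T\<close> _ know] first unfolding q_def by blast
  moreover have "\<bar>x\<bar> - \<bar>search A s t\<bar> \<le> \<bar>search A s t - x\<bar>"
    by linarith
  ultimately have "\<bar>x\<bar> + \<bar>q\<bar> \<le> t - T \<or> i \<noteq> s \<and> \<bar>x\<bar> - \<bar>search A s t\<bar> \<le> t - T"
    using diff by force
  then show thesis
    using that[of x j T] T first[OF know] m x diff by (auto simp: q_def)
qed

section \<open>Iterating the speed bound\<close>

text \<open>Only asymptotic, since each round of the iteration discards an initial time
  segment.\<close>

definition speed_bound :: "real \<Rightarrow> bool" where
  "speed_bound \<rho> \<longleftrightarrow> (\<exists>X. \<forall>i. \<forall>t>X. \<bar>search A i t\<bar> \<le> \<rho> * t)"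

lemma speed_bound_1: "speed_bound 1"
  using trajectory_abs_le[OF trajectory_search] by (auto simp: speed_bound_def intro!: exI[of _ 0])

lemma speed_bound_nonneg:
  assumes "speed_bound \<rho>"
  shows "0 \<le> \<rho>"
proof -
  obtain X where X: "\<And>i t. t > X \<Longrightarrow> \<bar>search A i t\<bar> \<le> \<rho> * t"
    using assms by (auto simp: speed_bound_def)
  define x where "x = max 1 \<bar>X\<bar> + 1"
  have x: "\<bar>x\<bar> > 1" "x > X"
    by (auto simp: x_def)
  obtain j T where "search A j T = x" "\<bar>x\<bar> \<le> T" "\<And>i t. knows x i t \<Longrightarrow> T \<le> t"
    using first_find[OF x(1)] by blast
  then have "0 < T" "\<bar>x\<bar> \<le> \<rho> * T"
    using X[of T j] x by auto
  then have "0 < T" "0 \<le> \<rho> * T"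
    by linarith+
  then show ?thesis
    by (simp add: zero_le_mult_iff)
qed

text \<open>The iteration starts at ratio 1, decreases, and stays nonnegative by
  \<open>speed_bound_nonneg\<close>, so \<open>step\<close> is only applied within
  \<open>[0, 1]\<close>.\<close>

lemma no_uniform_improvement:
  assumes "\<delta> > 0"
    and step: "\<And>\<rho>. 0 \<le> \<rho> \<Longrightarrow> \<rho> \<le> 1 \<Longrightarrow> speed_bound \<rho> \<Longrightarrow> speed_bound (\<rho> - \<delta>)"
  shows False
proof -
  have "speed_bound (1 - real n * \<delta>)" for n
  proof (induction n)
    case 0
    then show ?case
      using speed_bound_1 by simp
  next
    case (Suc n)
    then have "speed_bound (1 - real n * \<delta> - \<delta>)"
      using step speed_bound_nonneg \<open>\<delta> > 0\<close> by simp
    then show ?case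
      by (simp add: algebra_simps)
  qed
  moreover obtain n where "1 < real n * \<delta>"
    using reals_Archimedean3[OF \<open>\<delta> > 0\<close>] by blast
  ultimately show False
    using speed_bound_nonneg[of "1 - real n * \<delta>"] by simp
qed

text \<open>Solves \<open>a + q = t - a / \<rho>\<close> and \<open>t + q = \<beta> * a\<close> for \<open>q / t\<close>: an agent with speed ratio
  above this cannot have received the news of \<open>a\<close> directly.\<close>

definition cone_speed :: "real \<Rightarrow> real" where
  "cone_speed \<rho> = (\<beta> * \<rho> - 1 - \<rho>) / (\<beta> * \<rho> + 1 + \<rho>)"

text \<open>Multiplying the cone condition by \<open>\<rho>\<close> eliminates \<open>T\<close>
  without a division by \<open>\<rho>\<close>; a further factor \<open>\<beta>\<close> eliminates
  \<open>a\<close>.\<close>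

lemma cone_speed_bound:
  assumes "t + q = \<beta> * a" "a \<le> \<rho> * T" "a + q \<le> t - T" "0 \<le> \<rho>"
  shows "q \<le> cone_speed \<rho> * t"
proof -
  have "a * (1 + \<rho>) \<le> \<rho> * (t - q)"
    using mult_left_mono[OF assms(3,4)] assms(2) by (simp add: algebra_simps)
  then have "\<beta> * (a * (1 + \<rho>)) \<le> \<beta> * (\<rho> * (t - q))"
    using \<beta>_gt_3 by (intro mult_left_mono) auto
  moreover have "\<beta> * (a * (1 + \<rho>)) = (t + q) * (1 + \<rho>)"
    using assms(1) by simp
  ultimately have "q * (\<beta> * \<rho> + 1 + \<rho>) \<le> (\<beta> * \<rho> - 1 - \<rho>) * t"
    by (simp add: algebra_simps)
  moreover have "0 < \<beta> * \<rho> + 1 + \<rho>"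
    using \<beta>_gt_3 assms(4) by (simp add: add_nonneg_pos add_pos_nonneg)
  ultimately show ?thesis
    by (simp add: cone_speed_def pos_le_divide_eq)
qed

text \<open>At a late time the opposite target is remote and so was found late, hence eventual
  bounds also apply at \<open>T\<close>. Through \<open>Y\<close> a caller can ensure this for a
  bound of its own.\<close>

lemma eventually_opposite_target:
  assumes "speed_bound \<rho>" and \<rho>: "0 \<le> \<rho>"
  obtains X where "0 \<le> X"
    "\<And>i t. t > X \<Longrightarrow> \<exists>a j T. t + \<bar>search A i t\<bar> = \<beta> * a \<and> \<bar>search A j T\<bar> = a \<and> Y < T \<and> T \<le> t \<and>
      a \<le> \<rho> * T \<and> 0 < a \<and> \<bar>search A i t - search A j T\<bar> = a + \<bar>search A i t\<bar> \<and>
      (\<bar>search A i t\<bar> \<le> cone_speed \<rho> * t \<or> i \<noteq> s \<and> a - \<bar>search A s t\<bar> \<le> t - T)"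
proof -
  obtain X where X: "\<And>i t. t > X \<Longrightarrow> \<bar>search A i t\<bar> \<le> \<rho> * t"
    using assms by (auto simp: speed_bound_def)
  define Z where "Z = max 1 (max X Y)"
  have Z: "1 \<le> Z" "X \<le> Z" "Y \<le> Z"
    by (auto simp: Z_def)
  have "\<exists>a j T. t + \<bar>search A i t\<bar> = \<beta> * a \<and> \<bar>search A j T\<bar> = a \<and> Y < T \<and> T \<le> t \<and>
      a \<le> \<rho> * T \<and> 0 < a \<and> \<bar>search A i t - search A j T\<bar> = a + \<bar>search A i t\<bar> \<and>
      (\<bar>search A i t\<bar> \<le> cone_speed \<rho> * t \<or> i \<noteq> s \<and> a - \<bar>search A s t\<bar> \<le> t - T)"
    if t: "t > \<beta> * Z" for i t
  proof -
    have "\<beta> * 1 \<le> \<beta> * Z"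
      using \<beta>_gt_3 Z by (intro mult_left_mono) auto
    then have "\<beta> < t"
      using t by simp
    then obtain x j T where T: "t + \<bar>search A i t\<bar> = \<beta> * \<bar>x\<bar>" "search A j T = x" "\<bar>x\<bar> \<le> T" "T \<le> t"
      "\<bar>search A i t - x\<bar> = \<bar>x\<bar> + \<bar>search A i t\<bar>"
      "\<bar>x\<bar> + \<bar>search A i t\<bar> \<le> t - T \<or> i \<noteq> s \<and> \<bar>x\<bar> - \<bar>search A s t\<bar> \<le> t - T"
      using opposite_target by blast
    have "\<beta> * Z < \<beta> * \<bar>x\<bar>"
      using t T(1) by linarith
    then have "Z < \<bar>x\<bar>"
      using \<beta>_gt_3 by simp
    then have T': "Y < T" "X < T" "0 < \<bar>x\<bar>"
      using Z T(3) by linarith+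
    then have "\<bar>x\<bar> \<le> \<rho> * T"
      using X[of T j] T(2) by simp
    then show ?thesis
      using T T' cone_speed_bound[OF T(1) _ _ \<rho>] by blast
  qed
  moreover have "0 \<le> \<beta> * Z"
    using \<beta>_gt_3 Z by simp
  ultimately show thesis
    using that by blast
qed

text \<open>The sender hears nothing wirelessly, so it must be in the cone itself.\<close>

lemma sender_speed_bound:
  assumes "speed_bound \<rho>" "0 \<le> \<rho>"
  obtains X where "0 \<le> X" "\<And>t. t > X \<Longrightarrow> \<bar>search A s t\<bar> \<le> cone_speed \<rho> * t"
proof -
  obtain X where X: "0 \<le> X"
    "\<And>i t. t > X \<Longrightarrow> \<exists>a j T. t + \<bar>search A i t\<bar> = \<beta> * a \<and> \<bar>search A j T\<bar> = a \<and> 0 < T \<and> T \<le> t \<and>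
      a \<le> \<rho> * T \<and> 0 < a \<and> \<bar>search A i t - search A j T\<bar> = a + \<bar>search A i t\<bar> \<and>
      (\<bar>search A i t\<bar> \<le> cone_speed \<rho> * t \<or> i \<noteq> s \<and> a - \<bar>search A s t\<bar> \<le> t - T)"
    using eventually_opposite_target[OF assms, of 0] by blast
  have "\<bar>search A s t\<bar> \<le> cone_speed \<rho> * t" if "t > X" for t
    using X(2)[OF that, of s] by blast
  then show thesis
    using that X(1) by blast
qed

section \<open>Numerical estimates for \<open>\<beta>\<close> below the thresholds\<close>

lemma \<beta>_lt_5:
  assumes "\<beta>\<^sup>2 < 4 * \<beta> + 4"
  shows "\<beta> < 5"
proof (rule ccontr)
  assume \<beta>: "\<not> \<beta> < 5"
  then have "5 * \<beta> \<le> \<beta> * \<beta>"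
    using \<beta>_gt_3 by (intro mult_right_mono) auto
  then show False
    using assms \<beta> unfolding power2_eq_square by linarith
qed

lemma denominator_bounds:
  assumes "0 \<le> \<rho>" "\<rho> \<le> 1" "\<beta> < 5"
  shows "0 < \<beta> * \<rho> + 1 + \<rho>" "\<beta> * \<rho> + 1 + \<rho> \<le> 8"
proof -
  have "\<beta> * \<rho> \<le> 5 * 1"
    using \<beta>_gt_3 assms by (intro mult_mono) auto
  moreover have "0 \<le> \<beta> * \<rho>"
    using \<beta>_gt_3 assms by simp
  ultimately show "0 < \<beta> * \<rho> + 1 + \<rho>" "\<beta> * \<rho> + 1 + \<rho> \<le> 8"
    using assms by linarith+
qed

text \<open>An agent in the cone itself thus gains a fixed amount throughout
  \<open>3 < \<beta> < 5\<close>; the sharp conditions on \<open>\<beta>\<close> come from the other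
  cases.\<close>

lemma cone_speed_le:
  assumes "0 \<le> \<rho>" "\<rho> \<le> 1" "\<beta> < 5"
  shows "cone_speed \<rho> \<le> \<rho> - 1 / 16"
proof -
  note D = denominator_bounds[OF assms]
  \<comment> \<open>Completes the square in the numerator of
    \<open>\<rho> - cone_speed \<rho>\<close> reduced by \<open>1 / 2\<close>. That half over the
    denominator bound 8 gives \<open>1 / 16\<close>.\<close>
  have "4 * ((\<beta> + 1) * ((\<beta> + 1) * \<rho>\<^sup>2 + (2 - \<beta>) * \<rho> + 1 / 2)) =
      (2 * (\<beta> + 1) * \<rho> - (\<beta> - 2))\<^sup>2 + ((\<beta> - 3) * (5 - \<beta>) + 13 - 2 * \<beta>)"
    by (simp add: power2_eq_square algebra_simps)
  moreover have "0 \<le> (\<beta> - 3) * (5 - \<beta>)"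
    using \<beta>_gt_3 assms(3) by simp
  ultimately have "0 \<le> (\<beta> + 1) * ((\<beta> + 1) * \<rho>\<^sup>2 + (2 - \<beta>) * \<rho> + 1 / 2)"
    using assms(3) zero_le_power2[of "2 * (\<beta> + 1) * \<rho> - (\<beta> - 2)"] by linarith
  then have "1 / 2 \<le> (\<beta> + 1) * \<rho>\<^sup>2 + (2 - \<beta>) * \<rho> + 1"
    using \<beta>_gt_3 by (simp add: zero_le_mult_iff)
  then have "\<beta> * \<rho> - 1 - \<rho> \<le> \<rho> * (\<beta> * \<rho> + 1 + \<rho>) - 1 / 2"
    by (simp add: power2_eq_square algebra_simps)
  also have "\<dots> \<le> (\<rho> - 1 / 16) * (\<beta> * \<rho> + 1 + \<rho>)"
    using D(2) unfolding left_diff_distrib by simp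
  finally have "\<beta> * \<rho> - 1 - \<rho> \<le> (\<rho> - 1 / 16) * (\<beta> * \<rho> + 1 + \<rho>)" .
  then show ?thesis
    using D by (simp add: cone_speed_def pos_divide_le_eq)
qed

text \<open>With a single receiver, the opposite target was found by that receiver itself or by the
  sender, and the sender is slow.\<close>

lemma one_receiver_impossible:
  assumes one: "\<And>i j. i \<noteq> s \<Longrightarrow> j \<noteq> s \<Longrightarrow> i = j"
    and e: "\<beta>\<^sup>2 < 4 * \<beta> + 4"
  shows False
proof -
  define e where "e = 4 * \<beta> + 4 - \<beta>\<^sup>2"
  define \<delta> where "\<delta> = min 1 e / 16"
  have "\<beta> < 5"
    using \<beta>_lt_5 e \<beta>_gt_3 by simp
  have \<delta>: "0 < \<delta>" "\<delta> \<le> 1 / 16" "\<delta> \<le> e / 16"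
    using e by (auto simp: \<delta>_def e_def)
  show False
  proof (rule no_uniform_improvement[OF \<delta>(1)])
    fix \<rho> :: real
    assume \<rho>: "0 \<le> \<rho>" "\<rho> \<le> 1" and bound: "speed_bound \<rho>"
    define w where "w = cone_speed \<rho>"
    have w: "w \<le> \<rho> - \<delta>"
      using cone_speed_le[OF \<rho> \<open>\<beta> < 5\<close>] \<delta> by (simp add: w_def)
    note D = denominator_bounds[OF \<rho> \<open>\<beta> < 5\<close>]
    \<comment> \<open>The right-hand side equals \<open>(\<rho> + 1) * (\<beta> * \<rho> + 1 +
      \<rho>) - \<beta> * (\<beta> * \<rho> - 1 - \<rho>)\<close>, so \<open>e > 0\<close> is what
      leaves room for \<open>\<delta>\<close>.\<close>
    have "8 * \<delta> \<le> (\<beta> + 1) * (\<rho> - 1)\<^sup>2 + e * \<rho>"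
      using quadratic_lower_bound[of \<rho> e "\<beta> + 1"] \<rho> \<delta> \<beta>_gt_3 by simp
    moreover have "\<delta> * (\<beta> * \<rho> + 1 + \<rho>) \<le> \<delta> * 8"
      using D \<delta> by (intro mult_left_mono) auto
    ultimately have "\<beta> * (\<beta> * \<rho> - 1 - \<rho>) \<le> (\<rho> - \<delta> + 1) * (\<beta> * \<rho> + 1 + \<rho>)"
      by (simp add: e_def power2_eq_square algebra_simps)
    then have "\<beta> * w \<le> \<rho> - \<delta> + 1"
      using D(1) by (simp add: w_def cone_speed_def pos_divide_le_eq)
    then have \<beta>w: "\<beta> * w - 1 \<le> \<rho> - \<delta>"
      by simp
    obtain Y where Y: "0 \<le> Y" "\<And>t. t > Y \<Longrightarrow> \<bar>search A s t\<bar> \<le> w * t"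
      using sender_speed_bound[OF bound \<rho>(1)] by (auto simp: w_def)
    obtain X where X: "0 \<le> X"
      "\<And>i t. t > X \<Longrightarrow> \<exists>a j T. t + \<bar>search A i t\<bar> = \<beta> * a \<and> \<bar>search A j T\<bar> = a \<and> Y < T \<and> T \<le> t \<and>
        a \<le> \<rho> * T \<and> 0 < a \<and> \<bar>search A i t - search A j T\<bar> = a + \<bar>search A i t\<bar> \<and>
        (\<bar>search A i t\<bar> \<le> w * t \<or> i \<noteq> s \<and> a - \<bar>search A s t\<bar> \<le> t - T)"
      using eventually_opposite_target[OF bound \<rho>(1), of Y] unfolding w_def by blast
    have "\<bar>search A i t\<bar> \<le> (\<rho> - \<delta>) * t" if t: "t > X" for i t
    proof -
      obtain a j T where T: "t + \<bar>search A i t\<bar> = \<beta> * a" "\<bar>search A j T\<bar> = a" "Y < T" "T \<le> t"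
        "a \<le> \<rho> * T" "0 < a" "\<bar>search A i t - search A j T\<bar> = a + \<bar>search A i t\<bar>"
        "\<bar>search A i t\<bar> \<le> w * t \<or> i \<noteq> s"
        using X(2)[OF t, of i] by blast
      have "\<bar>search A i t\<bar> \<le> w * t \<or> \<bar>search A i t\<bar> \<le> (\<beta> * w - 1) * t"
      proof (cases "j = s")
        case True
        then have "a \<le> w * T" "0 < T"
          using Y T by auto
        \<comment> \<open>The sign of \<open>w\<close> permits replacing \<open>T\<close> by
          \<open>t\<close> in the bound on \<open>a\<close>.\<close>
        then have "0 \<le> w"
          using T(6) by (smt (verit) mult_less_0_iff)
        then have "a \<le> w * t"
          using \<open>a \<le> w * T\<close> mult_left_mono[OF T(4)] by force
        then have "\<beta> * a \<le> \<beta> * (w * t)"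
          using \<beta>_gt_3 by (intro mult_left_mono) auto
        then show ?thesis
          using T(1) by (simp add: algebra_simps)
      next
        case False
        show ?thesis
        proof (cases "i = s")
          case True
          then show ?thesis using T(8) by simp
        next
          case i: False
          \<comment> \<open>Here \<open>i = j\<close>: the receiver moved from the target to its
            present position itself, so it is in the cone whatever the sender does.\<close>
          then have "\<bar>search A i t - search A j T\<bar> \<le> t - T"
            using one[OF i False] trajectory_dist_le[OF trajectory_search, of T t] T(3,4) Y(1) by simp
          then show ?thesis
            using cone_speed_bound[OF T(1,5) _ \<rho>(1)] T(7) by (simp add: w_def)
        qed
      qed
      moreover have "0 \<le> t"
        using t X(1) by simp
      ultimately show ?thesis
        using mult_right_mono[OF w] mult_right_mono[OF \<beta>w] by force
    qed
    then show "speed_bound (\<rho> - \<delta>)"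
      by (auto simp: speed_bound_def)
  qed
qed

text \<open>The finder is arbitrary here, but an agent outside the cone owes its knowledge to a
  sender inside it. The sender's fixed ratio \<open>w\<close>, from the trivial bound 1, limits
  \<open>a + T\<close>.\<close>

lemma one_sender_impossible:
  assumes e: "\<beta>\<^sup>2 < 2 * \<beta> + 4"
  shows False
proof -
  define e where "e = 2 * \<beta> + 4 - \<beta>\<^sup>2"
  define \<delta> where "\<delta> = min 1 e / 16"
  have "\<beta> < 5"
    using \<beta>_lt_5 e \<beta>_gt_3 by simp
  have \<delta>: "0 < \<delta>" "\<delta> \<le> 1 / 16" "\<delta> \<le> e / 16"
    using e by (auto simp: \<delta>_def e_def)
  define w where "w = cone_speed 1"
  have w: "(\<beta> + 2) * (1 + w) = 2 * \<beta>"
    using \<beta>_gt_3 by (simp add: w_def cone_speed_def field_simps)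
  obtain Y where Y: "0 \<le> Y" "\<And>t. t > Y \<Longrightarrow> \<bar>search A s t\<bar> \<le> w * t"
    using sender_speed_bound[OF speed_bound_1] by (auto simp: w_def)
  show False
  proof (rule no_uniform_improvement[OF \<delta>(1)])
    fix \<rho> :: real
    assume \<rho>: "0 \<le> \<rho>" "\<rho> \<le> 1" and bound: "speed_bound \<rho>"
    \<comment> \<open>The right-hand side is \<open>(\<beta> + 2) * (1 + \<rho>)\<^sup>2 - 2 *
      \<beta>\<^sup>2 * \<rho>\<close>, again with \<open>e\<close> as the margin below the
      threshold.\<close>
    have "16 * \<delta> \<le> (\<beta> + 2) * (\<rho> - 1)\<^sup>2 + 2 * e * \<rho>"
      using quadratic_lower_bound[of \<rho> "2 * e" "\<beta> + 2"] \<rho> \<delta> \<beta>_gt_3 by simp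
    moreover have "\<delta> * ((\<beta> + 2) * (1 + \<rho>)) \<le> \<delta> * (8 * 2)"
      using \<open>\<beta> < 5\<close> \<beta>_gt_3 \<delta> \<rho> by (intro mult_left_mono mult_mono) auto
    ultimately have gain: "2 * \<beta>\<^sup>2 * \<rho> \<le> (\<rho> - \<delta> + 1) * ((\<beta> + 2) * (1 + \<rho>))"
      by (simp add: e_def power2_eq_square algebra_simps)
    obtain X where X: "0 \<le> X"
      "\<And>i t. t > X \<Longrightarrow> \<exists>a j T. t + \<bar>search A i t\<bar> = \<beta> * a \<and> \<bar>search A j T\<bar> = a \<and> Y < T \<and> T \<le> t \<and>
        a \<le> \<rho> * T \<and> 0 < a \<and> \<bar>search A i t - search A j T\<bar> = a + \<bar>search A i t\<bar> \<and>
        (\<bar>search A i t\<bar> \<le> cone_speed \<rho> * t \<or> i \<noteq> s \<and> a - \<bar>search A s t\<bar> \<le> t - T)"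
      using eventually_opposite_target[OF bound \<rho>(1), of Y] by blast
    have "\<bar>search A i t\<bar> \<le> (\<rho> - \<delta>) * t" if t: "t > X" for i t
    proof -
      have "0 \<le> t"
        using t X(1) by simp
      obtain a T where T: "t + \<bar>search A i t\<bar> = \<beta> * a" "Y < T" "T \<le> t" "a \<le> \<rho> * T"
        "\<bar>search A i t\<bar> \<le> cone_speed \<rho> * t \<or> a - \<bar>search A s t\<bar> \<le> t - T"
        using X(2)[OF t, of i] by blast
      show ?thesis
      proof (cases "\<bar>search A i t\<bar> \<le> cone_speed \<rho> * t")
        case True
        moreover have "cone_speed \<rho> \<le> \<rho> - \<delta>"
          using cone_speed_le[OF \<rho> \<open>\<beta> < 5\<close>] \<delta> by simp
        ultimately show ?thesis
          using mult_right_mono[OF _ \<open>0 \<le> t\<close>] by force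
      next
        case False
        \<comment> \<open>The sender is in the cone: \<open>a - w * t \<le> t - T\<close>. With
          \<open>a \<le> \<rho> * T\<close> this bounds \<open>a\<close>, and
          \<open>\<beta> * a - t\<close> is the distance sought.\<close>
        then have "a + T \<le> (1 + w) * t"
          using T Y(2)[of t] by (simp add: algebra_simps)
        then have "\<rho> * a + \<rho> * T \<le> \<rho> * ((1 + w) * t)"
          using mult_left_mono[OF _ \<rho>(1)] by (metis distrib_left)
        then have "a * (1 + \<rho>) \<le> \<rho> * ((1 + w) * t)"
          using T(4) by (simp add: algebra_simps)
        then have "\<beta> * (\<beta> + 2) * (a * (1 + \<rho>)) \<le> \<beta> * (\<beta> + 2) * (\<rho> * ((1 + w) * t))"
          using \<beta>_gt_3 by (intro mult_left_mono) auto
        also have "\<dots> = \<beta> * \<rho> * t * ((\<beta> + 2) * (1 + w))"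
          by (simp only: mult_ac)
        also have "\<dots> = 2 * \<beta>\<^sup>2 * \<rho> * t"
          unfolding w by (simp add: power2_eq_square)
        also have "\<dots> \<le> (\<rho> - \<delta> + 1) * ((\<beta> + 2) * (1 + \<rho>)) * t"
          using mult_right_mono[OF gain \<open>0 \<le> t\<close>] .
        also have "\<beta> * (\<beta> + 2) * (a * (1 + \<rho>)) = (t + \<bar>search A i t\<bar>) * ((\<beta> + 2) * (1 + \<rho>))"
          unfolding T(1) by (simp only: mult_ac)
        finally have "(t + \<bar>search A i t\<bar>) * ((\<beta> + 2) * (1 + \<rho>)) \<le>
            ((\<rho> - \<delta> + 1) * t) * ((\<beta> + 2) * (1 + \<rho>))"
          by (simp only: mult_ac)
        moreover have "0 < (\<beta> + 2) * (1 + \<rho>)"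
          using \<beta>_gt_3 \<rho> by simp
        ultimately have "t + \<bar>search A i t\<bar> \<le> (\<rho> - \<delta> + 1) * t"
          using mult_right_le_imp_le by blast
        then show ?thesis
          by (simp add: algebra_simps)
      qed
    qed
    then show "speed_bound (\<rho> - \<delta>)"
      by (auto simp: speed_bound_def)
  qed
qed

end

section \<open>From the competitive ratio to the contradiction\<close>

lemma reached_before:
  assumes alg: "competitive_ratio A < ereal c" and x: "\<bar>x\<bar> > 1"
  shows "\<exists>t\<ge>0. move A x i t = x \<and> t < c * \<bar>x\<bar>"
proof -
  have "evacuation_time A x / ereal \<bar>x\<bar> \<le> competitive_ratio A"
    unfolding competitive_ratio_def using x by (intro SUP_upper) simp
  then have "evacuation_time A x / ereal \<bar>x\<bar> < ereal c"
    using alg by simp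
  then have "evacuation_time A x < ereal c * ereal \<bar>x\<bar>"
    using x by (subst (asm) ereal_divide_less_pos) (auto simp: mult.commute)
  moreover have "(INF t\<in>{t. 0 \<le> t \<and> move A x i t = x}. ereal t) \<le> evacuation_time A x"
    unfolding evacuation_time_def by (intro SUP_upper) simp
  ultimately have "(INF t\<in>{t. 0 \<le> t \<and> move A x i t = x}. ereal t) < ereal (c * \<bar>x\<bar>)"
    by simp
  \<comment> \<open>Without any visit the infimum would be \<open>\<infinity>\<close>, so some visit
    time lies below the bound.\<close>
  then show ?thesis
    by (auto simp: INF_less_iff)
qed

theorem theorem10:
  fixes kind :: "'a::finite \<Rightarrow> agent_kind" and A :: "'a algorithm" and n_r :: nat
  assumes "card {i. kind i = Sender} = 1"
    and "card {i. kind i = Receiver} = n_r"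
    and "n_r \<ge> 1"
    and "evacuation_algorithm kind A"
  shows "competitive_ratio A \<ge> ereal (if n_r = 1 then 3 + 2 * sqrt 2 else 2 + sqrt 5)"
proof (rule ccontr)
  define b :: real where "b = (if n_r = 1 then 3 + 2 * sqrt 2 else 2 + sqrt 5)"
  assume "\<not> ?thesis"
  then have less: "competitive_ratio A < ereal b"
    by (simp add: b_def)
  have "2 < sqrt 5"
    by (simp add: real_less_rsqrt)
  moreover have "1 < 2 * sqrt 2"
    using real_sqrt_ge_one[of 2] by linarith
  ultimately have "4 < b"
    by (simp add: b_def)
  \<comment> \<open>Strictness below gives strict arrival times, strictness above the strict
    quadratic inequalities in \<open>\<beta>\<close>.\<close>
  then obtain c where c: "max (competitive_ratio A) 4 < ereal c" "c < b"
    using ereal_dense2[of "max (competitive_ratio A) 4" "ereal b"] less by auto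
  obtain s where s: "{i. kind i = Sender} = {s}"
    using assms(1) card_1_singletonE by blast
  have "4 < c"
    using c(1) by simp
  interpret fast_evacuation kind A s c
    using assms(4) s \<open>4 < c\<close> reached_before c(1) by unfold_locales auto
  show False
  proof (cases "n_r = 1")
    case True
    then obtain r where r: "{i. kind i = Receiver} = {r}"
      using assms(2) card_1_singletonE by blast
    have "i = r" if "i \<noteq> s" for i
      using that sender r agent_kind.exhaust[of "kind i"] by blast
    \<comment> \<open>As \<open>c = \<beta> + 1\<close>, this reads
      \<open>(\<beta> - 2)\<^sup>2 < 8\<close>; the other case similarly becomes
      \<open>(\<beta> - 1)\<^sup>2 < 5\<close>.\<close>
    moreover have "(c - 3)\<^sup>2 < (2 * sqrt 2)\<^sup>2"
      using True c(2) \<open>4 < c\<close> by (intro power_strict_mono) (auto simp: b_def)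
    then have "\<beta>\<^sup>2 < 4 * \<beta> + 4"
      by (simp add: \<beta>_def power2_eq_square algebra_simps)
    ultimately show ?thesis
      using one_receiver_impossible by metis
  next
    case False
    then have "(c - 2)\<^sup>2 < (sqrt 5)\<^sup>2"
      using c(2) \<open>4 < c\<close> by (intro power_strict_mono) (auto simp: b_def)
    then have "\<beta>\<^sup>2 < 2 * \<beta> + 4"
      by (simp add: \<beta>_def power2_eq_square algebra_simps)
    then show ?thesis
      using one_sender_impossible by blast
  qed
qed

end
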